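(* Let $\lambda=(\lambda_1,\ldots,\lambda_l)$ be a partition of length $l$ and let $k$ be a positive integer. Then $$q^*_{k}S_{\lambda}.1=\sum_{\mu}(1-t)^{l}\,\det M(\lambda/\mu;t)\;S_{\mu}.1,$$ where the sum is over all partitions $\mu\subset\lambda$ such that $|\lambda/\mu|=k$, and $M(\lambda/\mu;t)$ is the $l\times l$ matrix with $(i,j)$-entry $$\delta_{\lambda_i-i\ge\mu_j-j}\,(1-t)^{-\delta_{\lambda_i-i,\;\mu_j-j}} .$$
   Context: $\Lambda$ is the ring of symmetric functions over $\mathbb Q(t)$, a polynomial ring in the power sums $p_1,p_2,\dots$, with the bilinear form $\langle p_\lambda,p_\mu\rangle=\delta_{\lambda\mu}z_\lambda$, $z_\lambda=\prod_i i^{m_i(\lambda)}m_i(\lambda)!$. The operators $S_n$ ($n\in\mathbb Z$) on $\Lambda$ are defined by $$\exp\Big(\sum_{n\ge1}\tfrac1np_nz^n\Big)\exp\Big(-\sum_{n\ge1}\tfrac{\partial}{\partial p_n}z^{-n}\Big)=\sum_{n\in\mathbb Z}S_nz^n,$$ and $S_\lambda.1=S_{\lambda_1}\cdots S_{\lambda_l}.1$, which for a partition $\lambda$ is the Schur function $s_\lambda$. The operators $q_n^*$ on $\Lambda$ (adjoint to multiplication by $q_n$, where $\sum_{n\ge 0} q_nz^n=\exp(\sum_{n\ge1}\frac{1-t^n}{n}p_nz^n)$) are defined by $\exp\big(\sum_{n\ge1}(1-t^n)\frac{\partial}{\partial p_n}z^{-n}\big)=\sum_{n\ge0}q_n^*z^{-n}$.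 $\delta_{a\ge b}$ is $1$ if $a\ge b$ and $0$ otherwise; $\delta_{a,b}$ is the Kronecker delta. A partition $\mu\subset\lambda$ (i.e. $\mu_i\le\lambda_i$ for all $i$) is regarded as having $l$ entries by appending zeros, and $|\lambda/\mu|=|\lambda|-|\mu|$. *)

theory Defs
  imports
    "HOL-Library.Poly_Mapping"
    "HOL-Computational_Algebra.Polynomial"
    "HOL-Computational_Algebra.Fraction_Field"
    "Jordan_Normal_Form.Determinant"
begin

text \<open>The field \<open>\<rat>(t)\<close> and the ring \<open>\<Lambda> = \<rat>(t)[p\<^sub>1, p\<^sub>2, \<dots>]\<close>.\<close>

type_synonym ratfun = "rat poly fract"

type_synonym symfun = "(nat \<Rightarrow>\<^sub>0 nat) \<Rightarrow>\<^sub>0 ratfun"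

definition tvar :: ratfun where
  "tvar = Fract [:0, 1:] 1"

definition scal :: "ratfun \<Rightarrow> symfun \<Rightarrow> symfun" where
  "scal c f = Poly_Mapping.single 0 c * f"

text \<open>The indeterminates of \<^typ>\<open>symfun\<close> are numbered from \<open>0\<close>, and \<open>p\<^sub>n\<close> is the one with number
  \<open>n - 1\<close>. Only \<open>n \<ge> 1\<close> is meaningful in the next two definitions.\<close>

definition psum :: "nat \<Rightarrow> symfun" where
  "psum n = Poly_Mapping.single (Poly_Mapping.single (n - 1) 1) 1"

text \<open>The derivation \<open>\<partial>/\<partial>p\<^sub>n\<close>, monomial by monomial. When the exponent of \<open>p\<^sub>n\<close> in \<open>m\<close> is \<open>0\<close>, the
  truncated difference of exponents is multiplied by \<open>0\<close>.\<close>

definition pderiv_p :: "nat \<Rightarrow> symfun \<Rightarrow> symfun" where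
  "pderiv_p n f =
    (\<Sum>m\<in>Poly_Mapping.keys f.
       Poly_Mapping.single (m - Poly_Mapping.single (n - 1) 1)
         (of_nat (Poly_Mapping.lookup m (n - 1)) * Poly_Mapping.lookup f m))"

text \<open>For a sequence \<open>A\<close> of operators, \<open>op_series_power A k m\<close> is the coefficient of \<open>w\<^sup>m\<close> in
  \<open>(\<Sum>n\<ge>1. A\<^sub>n w\<^sup>n)\<^sup>k\<close> and \<open>op_exp A m\<close> is the coefficient of \<open>w\<^sup>m\<close> in \<open>exp (\<Sum>n\<ge>1. A\<^sub>n w\<^sup>n)\<close>; the
  powers with \<open>k > m\<close> do not contribute to the latter. Below, \<open>w\<close> is \<open>z\<close> or \<open>z\<close> inverse.\<close>

fun op_series_power ::
  "(nat \<Rightarrow> symfun \<Rightarrow> symfun) \<Rightarrow> nat \<Rightarrow> nat \<Rightarrow> symfun \<Rightarrow> symfun" where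
  "op_series_power A 0 m f = (if m = 0 then f else 0)"
| "op_series_power A (Suc k) m f = (\<Sum>n=1..m. A n (op_series_power A k (m - n) f))"

definition op_exp :: "(nat \<Rightarrow> symfun \<Rightarrow> symfun) \<Rightarrow> nat \<Rightarrow> symfun \<Rightarrow> symfun" where
  "op_exp A m f = (\<Sum>k\<le>m. scal (1 / of_nat (fact k)) (op_series_power A k m f))"

text \<open>\<open>S\<^sub>n\<close> is the coefficient of \<open>z\<^sup>n\<close> in the product of the two exponentials. The coefficient of
  \<open>z\<close> to the power \<open>-i\<close> in the second one lowers the degree by \<open>i\<close> (with \<open>p\<^sub>n\<close> in degree \<open>n\<close>), so on
  each \<open>f\<close> only finitely many \<open>i\<close> contribute to the sum.\<close>

definition S_op :: "int \<Rightarrow> symfun \<Rightarrow> symfun" where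
  "S_op n f =
    Sum_any (\<lambda>i::nat.
      if n + int i \<ge> 0
      then op_exp (\<lambda>r g. scal (1 / of_nat r) (psum r * g)) (nat (n + int i))
             (op_exp (\<lambda>r g. - pderiv_p r g) i f)
      else 0)"

definition S_one :: "nat list \<Rightarrow> symfun" where
  "S_one lam = foldr (\<lambda>n f. S_op (int n) f) lam 1"

definition q_star :: "nat \<Rightarrow> symfun \<Rightarrow> symfun" where
  "q_star = op_exp (\<lambda>r g. scal (1 - tvar ^ r) (pderiv_p r g))"

definition is_partition :: "nat list \<Rightarrow> bool" where
  "is_partition lam \<longleftrightarrow> sorted_wrt (\<ge>) lam \<and> (\<forall>a\<in>set lam. a > 0)"

text \<open>The parts of a partition, continued by zeros and numbered from \<open>0\<close>.\<close>

definition part :: "nat list \<Rightarrow> nat \<Rightarrow> nat" where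
  "part lam i = (if i < length lam then lam ! i else 0)"

definition part_subset :: "nat list \<Rightarrow> nat list \<Rightarrow> bool" where
  "part_subset mu lam \<longleftrightarrow> (\<forall>i. part mu i \<le> part lam i)"

text \<open>Rows and columns of \<open>M(\<lambda>/\<mu>; t)\<close> are numbered from \<open>0\<close>; the size is the length of \<open>lam\<close>.\<close>

definition skew_mat :: "nat list \<Rightarrow> nat list \<Rightarrow> ratfun mat" where
  "skew_mat lam mu = mat (length lam) (length lam) (\<lambda>(i, j).
     let a = int (part lam i) - int (i + 1);
         b = int (part mu j) - int (j + 1)
     in of_bool (a \<ge> b) * (1 - tvar) powi (- of_bool (a = b)))"

end

theory Submission
  imports Defs
begin

text \<open>Write \<open>S(w) = \<Sum>S\<^sub>n w\<^sup>n\<close> and \<open>q\<^sup>*(z) = \<Sum>q\<^sub>n\<^sup>* z\<^sup>-\<^sup>n\<close>. The lowering exponentials in both are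
  homomorphisms which shift the power sums by constants. They commute with each other and multiply
  \<open>exp (\<Sum>p\<^sub>n w\<^sup>n / n) = \<Sum>h\<^sub>n w\<^sup>n\<close> by a scalar series (\<open>shift_hsym\<close>). This has two consequences.

  First, \<open>q\<^sup>*(z) S(w) = (1 - t w/z) / (1 - w/z) S(w) q\<^sup>*(z)\<close>. Hence \<open>q\<^sub>k\<^sup>* S\<^sub>n = \<Sum>c\<^sub>j S\<^sub>n\<^sub>-\<^sub>j q\<^sub>k\<^sub>-\<^sub>j\<^sup>*\<close> with \<open>c\<^sub>0 = 1\<close> and
  \<open>c\<^sub>j = 1 - t\<close> for \<open>j > 0\<close> (\<open>q_star_S_op\<close>). As \<open>q\<^sub>k\<^sup>*\<close> kills \<open>1\<close> for \<open>k > 0\<close>, the function \<open>q\<^sub>k\<^sup>* S\<^sub>\<lambda>.1\<close> is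
  the sum of the \<open>S\<^sub>\<lambda>\<^sub>-\<^sub>\<alpha>.1\<close> over the \<open>\<alpha> \<in> \<nat>\<^sup>l\<close> with \<open>|\<alpha>| = k\<close>, each multiplied by the \<open>c\<close> of all entries of \<open>\<alpha>\<close>.

  Second, \<open>S\<^sub>a S\<^sub>b = - S\<^sub>b\<^sub>-\<^sub>1 S\<^sub>a\<^sub>+\<^sub>1\<close> (\<open>S_op_anticommute\<close>). So \<open>S\<^sub>\<nu>.1\<close>, for an integer vector \<open>\<nu>\<close>, is an alternating
  function of the numbers \<open>\<nu>\<^sub>i - i\<close>. Collecting the vectors \<open>\<nu> = \<lambda> - \<alpha>\<close> whose numbers \<open>\<nu>\<^sub>i - i\<close> form the same
  set \<open>{\<mu>\<^sub>j - j}\<close> with weakly decreasing \<open>\<mu>\<close>, one obtains \<open>S\<^sub>\<mu>.1\<close> with a determinant as coefficient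
  (\<open>q_star_int_S_seq\<close>). Its \<open>(i, j)\<close>-entry is \<open>c\<close> at the index \<open>(\<lambda>\<^sub>i - i) - (\<mu>\<^sub>j - j)\<close>, where \<open>c\<close> vanishes at
  negative indices. The matrix is
  \<open>(1 - t) M(\<lambda>/\<mu>; t)\<close>.

  It remains to see which \<open>\<mu>\<close> survive. If \<open>\<mu>\<^sub>l < 0\<close> then \<open>S\<^sub>\<mu>.1 = 0\<close>, since \<open>S\<^sub>n.1 = h\<^sub>n\<close>. If \<open>\<mu>\<^sub>j > \<lambda>\<^sub>j\<close> for
  some \<open>j\<close>, the matrix has a zero block too large for a nonzero determinant. The others are the
  partitions \<open>\<mu> \<subset> \<lambda>\<close>, continued by zeros, and \<open>S\<^sub>0.1 = 1\<close> lets one drop the zeros.\<close>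

section \<open>Exponentials of series of commuting operators\<close>

lemma vector_space_scal: "vector_space scal"
  by unfold_locales
    (simp_all add: scal_def single_add algebra_simps mult_single flip: mult.assoc)

interpretation symfun: vector_space scal
  by (rule vector_space_scal)

interpretation symfun_hom: vector_space_pair scal scal ..

abbreviation linear_op :: "(symfun \<Rightarrow> symfun) \<Rightarrow> bool" where
  "linear_op \<equiv> Vector_Spaces.linear scal scal"

lemma linear_opI:
  assumes "\<And>f g. A (f + g) = A f + A g" and "\<And>c f. A (scal c f) = scal c (A f)"
  shows "linear_op A"
  using assms by (simp add: Vector_Spaces.linear_iff vector_space_scal)

lemmas linear_op_add = symfun_hom.linear_add
  and linear_op_scal = symfun_hom.linear_scale
  and linear_op_sum = symfun_hom.linear_sum
  and linear_op_zero = symfun_hom.linear_0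

lemma scal_of_nat: "scal (of_nat n) f = of_nat n * f"
  by (simp add: scal_def)

lemma linear_op_of_nat: "linear_op A \<Longrightarrow> A (of_nat n * f) = of_nat n * A f"
  by (metis linear_op_scal scal_of_nat)

lemma scal_mult_left: "scal c f * g = scal c (f * g)"
  and scal_mult_right: "f * scal c g = scal c (f * g)"
  by (simp_all add: scal_def mult_ac)

lemma sum_triangle_swap:
  fixes F :: "nat \<Rightarrow> nat \<Rightarrow> 'a::comm_monoid_add"
  shows "(\<Sum>n=1..m. \<Sum>r=1..m-n. F n r) = (\<Sum>r=1..m. \<Sum>n=1..m-r. F n r)"
  unfolding sum.Sigma[OF finite_atLeastAtMost ballI[OF finite_atLeastAtMost]]
  by (rule sum.reindex_bij_witness[of _ "\<lambda>(r, n). (n, r)" "\<lambda>(n, r). (r, n)"]) auto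

lemma sum_triangle_below:
  fixes F :: "nat \<Rightarrow> nat \<Rightarrow> 'a::comm_monoid_add"
  shows "(\<Sum>i\<le>m. \<Sum>r=1..i. F i r) = (\<Sum>r=1..m. \<Sum>i\<le>m-r. F (i + r) r)"
  unfolding sum.Sigma[OF finite_atLeastAtMost ballI[OF finite_atMost]]
    sum.Sigma[OF finite_atMost ballI[OF finite_atLeastAtMost]]
  by (rule sum.reindex_bij_witness[of _ "\<lambda>(r, i). (i + r, r)" "\<lambda>(i, r). (r, i - r)"]) auto

lemma sum_triangle_above:
  fixes F :: "nat \<Rightarrow> nat \<Rightarrow> 'a::comm_monoid_add"
  shows "(\<Sum>i\<le>m. \<Sum>r=1..m-i. F i r) = (\<Sum>r=1..m. \<Sum>i\<le>m-r. F i r)"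
  unfolding sum.Sigma[OF finite_atLeastAtMost ballI[OF finite_atMost]]
    sum.Sigma[OF finite_atMost ballI[OF finite_atLeastAtMost]]
  by (rule sum.reindex_bij_witness[of _ "\<lambda>(r, i). (i, r)" "\<lambda>(i, r). (r, i)"]) auto

lemma op_series_power_eq_0: "k > m \<Longrightarrow> (\<And>r. linear_op (A r)) \<Longrightarrow> op_series_power A k m f = 0"
proof (induction k arbitrary: m)
  case (Suc k)
  have "A n (op_series_power A k (m - n) f) = 0" if "n \<in> {1..m}" for n
    using Suc that by (subst Suc.IH) (auto simp: linear_op_zero)
  then show ?case by simp
qed simp

text \<open>This is \<open>w d/dw A(w)\<^sup>k\<^sup>+\<^sup>1 = (k+1) (w A'(w)) A(w)\<^sup>k\<close>, read off at \<open>w\<^sup>m\<close>: commuting coefficients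
  let the derivative of a power be computed as in a commutative ring. The induction is the product
  rule for \<open>A(w) A(w)\<^sup>k\<close>, with \<open>m\<close> split as \<open>n + (m - n)\<close>.\<close>
lemma op_series_power_deriv:
  assumes lin: "\<And>r. linear_op (A r)" and comm: "\<And>r s f. A r (A s f) = A s (A r f)"
  shows "of_nat m * op_series_power A (Suc k) m f =
    of_nat (Suc k) * (\<Sum>r=1..m. of_nat r * A r (op_series_power A k (m - r) f))"
proof (induction k arbitrary: m)
  case 0
  have "A n (if m - n = 0 then f else 0) = (if n = m then A n f else 0)" if "n \<in> {1..m}" for n
    using that by (auto simp: linear_op_zero[OF lin])
  then have "(\<Sum>n=1..m. A n (if m - n = 0 then f else 0)) = (if m = 0 then 0 else A m f)"
    and "(\<Sum>n=1..m. of_nat n * A n (if m - n = 0 then f else 0)) = (if m = 0 then 0 else of_nat m * A m f)"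
    by (simp_all add: if_distrib[of "\<lambda>x. _ * x"] cong: if_cong)
  then show ?case by (simp del: diff_is_0_eq)
next
  case (Suc k)
  let ?P = "op_series_power A"
  define D where "D = (\<Sum>r=1..m. of_nat r * A r (?P (Suc k) (m - r) f))"
  have "of_nat m * ?P (Suc (Suc k)) m f =
      (\<Sum>n=1..m. (of_nat n + of_nat (m - n)) * A n (?P (Suc k) (m - n) f))"
    unfolding op_series_power.simps(2)[of A "Suc k"] sum_distrib_left
    by (intro sum.cong refl) (simp flip: of_nat_add)
  also have "\<dots> = D + (\<Sum>n=1..m. A n (of_nat (m - n) * ?P (Suc k) (m - n) f))"
    by (simp only: D_def distrib_right sum.distrib linear_op_of_nat[OF lin])
  also have "(\<Sum>n=1..m. A n (of_nat (m - n) * ?P (Suc k) (m - n) f)) =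
      (\<Sum>n=1..m. \<Sum>r=1..m-n. of_nat (Suc k) * (of_nat r * A r (A n (?P k (m - n - r) f))))"
    unfolding Suc.IH linear_op_of_nat[OF lin] linear_op_sum[OF lin] comm[of _ _ "?P k _ f"]
    by (simp add: linear_op_of_nat[OF lin] linear_op_sum[OF lin] sum_distrib_left comm del: of_nat_Suc)
  also have "\<dots> = (\<Sum>r=1..m. \<Sum>n=1..m-r. of_nat (Suc k) * (of_nat r * A r (A n (?P k (m - n - r) f))))"
    by (rule sum_triangle_swap)
  also have "\<dots> = of_nat (Suc k) * D"
    unfolding D_def
    by (simp add: linear_op_sum[OF lin] sum_distrib_left diff_commute add.commute)
  finally show ?case
    by (simp add: D_def algebra_simps del: op_series_power.simps)
qed

text \<open>The differential equation \<open>w E' = (w A') E\<close> of \<open>E = exp A(w)\<close>. Since \<open>m\<close> is invertible in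
  characteristic zero, it determines the coefficients of \<open>E\<close> one after the other. Commutation,
  multiplicativity and the values on generators are proved below by induction with this recursion.\<close>
lemma op_exp_recursion:
  assumes lin: "\<And>r. linear_op (A r)" and comm: "\<And>r s f. A r (A s f) = A s (A r f)"
  shows "of_nat m * op_exp A m f = (\<Sum>r=1..m. of_nat r * A r (op_exp A (m - r) f))"
proof (cases m)
  case (Suc m')
  let ?P = "op_series_power A"
  have extend: "op_exp A (m - r) f = (\<Sum>k<m. scal (1 / of_nat (fact k)) (?P k (m - r) f))"
    if "r \<in> {1..m}" for r
    unfolding op_exp_def using that
    by (intro sum.mono_neutral_left) (auto simp: op_series_power_eq_0[OF _ lin])
  have step: "of_nat m * scal (1 / of_nat (fact (Suc k))) (?P (Suc k) m f) =
      (\<Sum>r=1..m. of_nat r * A r (scal (1 / of_nat (fact k)) (?P k (m - r) f)))" for k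
  proof -
    have "of_nat m * scal (1 / of_nat (fact (Suc k))) (?P (Suc k) m f) =
        scal (1 / of_nat (fact (Suc k))) (scal (of_nat (Suc k)) (\<Sum>r=1..m. of_nat r * A r (?P k (m - r) f)))"
      unfolding scal_mult_right op_series_power_deriv[OF lin comm] scal_of_nat ..
    also have "\<dots> = scal (1 / of_nat (fact k)) (\<Sum>r=1..m. of_nat r * A r (?P k (m - r) f))"
    proof -
      have "1 / of_nat (fact (Suc k)) * of_nat (Suc k) = (1 / of_nat (fact k) :: ratfun)"
        unfolding fact_Suc of_nat_mult by (simp del: of_nat_Suc of_nat_fact)
      then show ?thesis by (simp del: of_nat_Suc of_nat_fact)
    qed
    also have "\<dots> = (\<Sum>r=1..m. of_nat r * A r (scal (1 / of_nat (fact k)) (?P k (m - r) f)))"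
      by (simp add: symfun.scale_sum_right scal_mult_right linear_op_scal[OF lin])
    finally show ?thesis .
  qed
  have "of_nat m * op_exp A m f = of_nat m * (\<Sum>k<m. scal (1 / of_nat (fact (Suc k))) (?P (Suc k) m f))"
    unfolding op_exp_def using Suc
    by (subst sum.atMost_shift) simp
  also have "\<dots> = (\<Sum>k<m. \<Sum>r=1..m. of_nat r * A r (scal (1 / of_nat (fact k)) (?P k (m - r) f)))"
    unfolding sum_distrib_left step ..
  also have "\<dots> = (\<Sum>r=1..m. \<Sum>k<m. of_nat r * A r (scal (1 / of_nat (fact k)) (?P k (m - r) f)))"
    by (rule sum.swap)
  also have "\<dots> = (\<Sum>r=1..m. of_nat r * A r (op_exp A (m - r) f))"
    by (intro sum.cong refl) (simp add: extend linear_op_sum[OF lin] sum_distrib_left)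
  finally show ?thesis .
qed simp

lemma op_exp_0: "op_exp A 0 f = f"
  by (simp add: op_exp_def)

lemma linear_op_op_exp:
  assumes lin: "\<And>r. linear_op (A r)"
  shows "linear_op (op_exp A m)"
proof -
  have P: "linear_op (op_series_power A k m)" for k m
  proof (induction k arbitrary: m)
    case 0
    show ?case by (auto intro: linear_opI)
  next
    case (Suc k)
    show ?case
      by (rule linear_opI)
        (simp_all add: linear_op_add[OF lin] linear_op_add[OF Suc.IH] linear_op_scal[OF lin]
          linear_op_scal[OF Suc.IH] sum.distrib symfun.scale_sum_right)
  qed
  show ?thesis
    unfolding op_exp_def
    by (rule linear_opI)
      (simp_all add: linear_op_add[OF P] linear_op_scal[OF P] sum.distrib symfun.scale_sum_right
        symfun.scale_right_distrib mult.commute)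
qed

lemma op_exp_commute_op:
  assumes lin: "\<And>r. linear_op (A r)" and comm: "\<And>r s f. A r (A s f) = A s (A r f)"
    and linB: "linear_op B" and AB: "\<And>r f. A r (B f) = B (A r f)"
  shows "op_exp A m (B f) = B (op_exp A m f)"
proof (induction m rule: less_induct)
  case (less m)
  show ?case
  proof (cases "m = 0")
    case False
    have "of_nat m * op_exp A m (B f) = of_nat m * B (op_exp A m f)"
      unfolding linear_op_of_nat[OF linB, symmetric] op_exp_recursion[OF lin comm] linear_op_sum[OF linB]
      using less by (intro sum.cong refl) (simp add: linear_op_of_nat[OF linB] AB)
    then show ?thesis using False by simp
  qed (simp add: op_exp_0)
qed

lemma op_exp_commute:
  assumes "\<And>r. linear_op (A r)" "\<And>r s f. A r (A s f) = A s (A r f)"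
    and "\<And>r. linear_op (B r)" "\<And>r s f. B r (B s f) = B s (B r f)"
    and "\<And>r s f. A r (B s f) = B s (A r f)"
  shows "op_exp A m (op_exp B n f) = op_exp B n (op_exp A m f)"
  using assms by (intro op_exp_commute_op linear_op_op_exp) (simp_all add: op_exp_commute_op)

text \<open>The exponential of a series of derivations is multiplicative, because both sides satisfy
  the same differential equation.\<close>
lemma op_exp_mult:
  assumes lin: "\<And>r. linear_op (A r)" and comm: "\<And>r s f. A r (A s f) = A s (A r f)"
    and deriv: "\<And>r f g. A r (f * g) = A r f * g + f * A r g"
  shows "op_exp A m (f * g) = (\<Sum>i\<le>m. op_exp A i f * op_exp A (m - i) g)"
proof (induction m rule: less_induct)
  case (less m)
  let ?E = "op_exp A"
  note rec = op_exp_recursion[OF lin comm]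
  show ?case
  proof (cases "m = 0")
    case False
    have "of_nat m * (\<Sum>i\<le>m. ?E i f * ?E (m - i) g) =
        (\<Sum>i\<le>m. (of_nat i * ?E i f) * ?E (m - i) g + ?E i f * (of_nat (m - i) * ?E (m - i) g))"
      unfolding sum_distrib_left
      by (intro sum.cong refl) (simp add: of_nat_diff algebra_simps)
    also have "\<dots> = (\<Sum>i\<le>m. \<Sum>r=1..i. of_nat r * (A r (?E (i - r) f) * ?E (m - i) g)) +
        (\<Sum>i\<le>m. \<Sum>r=1..m-i. of_nat r * (?E i f * A r (?E (m - i - r) g)))"
      unfolding rec by (simp add: sum.distrib sum_distrib_left sum_distrib_right mult_ac)
    also have "\<dots> = (\<Sum>r=1..m. of_nat r * A r (\<Sum>i\<le>m-r. ?E i f * ?E (m - r - i) g))"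
      unfolding sum_triangle_above sum_triangle_below
      by (simp add: linear_op_sum[OF lin] deriv sum.distrib sum_distrib_left distrib_left diff_commute
          add.commute)
    also have "\<dots> = of_nat m * ?E m (f * g)"
      unfolding rec using less by (intro sum.cong refl) simp
    finally show ?thesis using False by simp
  qed (simp add: op_exp_0)
qed

section \<open>Shifts of the power sums\<close>

text \<open>Identities between linear operators, and between derivations, need only be checked on
  monomials.\<close>
lemma symfun_induct [case_names monomial add]:
  fixes f :: symfun
  assumes monomial: "\<And>m c. P (Poly_Mapping.single m c)" and add: "\<And>f g. P f \<Longrightarrow> P g \<Longrightarrow> P (f + g)"
  shows "P f"
proof (induction f rule: Poly_Mapping.update_induct)
  case const
  then show ?case using monomial[of 0 0] by simp
next
  case (update f a b)
  have "Poly_Mapping.update a b f = f + Poly_Mapping.single a b"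
    using update by (intro poly_mapping_eqI)
      (auto simp: lookup_update lookup_add lookup_single when_def in_keys_iff)
  then show ?case using update add monomial by simp
qed

lemma pderiv_p_superset:
  assumes "finite K" and "Poly_Mapping.keys f \<subseteq> K"
  shows "pderiv_p n f = (\<Sum>m\<in>K. Poly_Mapping.single (m - Poly_Mapping.single (n - 1) 1)
    (of_nat (Poly_Mapping.lookup m (n - 1)) * Poly_Mapping.lookup f m))"
  unfolding pderiv_p_def using assms
  by (intro sum.mono_neutral_left) (auto simp: in_keys_iff)

lemma pderiv_p_monomial: "pderiv_p n (Poly_Mapping.single m c) =
    Poly_Mapping.single (m - Poly_Mapping.single (n - 1) 1) (of_nat (Poly_Mapping.lookup m (n - 1)) * c)"
  by (subst pderiv_p_superset[of "{m}"]) auto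

lemma pderiv_p_add: "pderiv_p n (f + g) = pderiv_p n f + pderiv_p n g"
proof -
  let ?K = "Poly_Mapping.keys f \<union> Poly_Mapping.keys g"
  have "Poly_Mapping.keys (f + g) \<subseteq> ?K" by (rule Poly_Mapping.keys_add)
  then show ?thesis
    by (simp add: pderiv_p_superset[of ?K] lookup_add distrib_left single_add sum.distrib)
qed

lemma pderiv_p_mult: "pderiv_p n (f * g) = pderiv_p n f * g + f * pderiv_p n g"
proof (induction f rule: symfun_induct)
  case (add f f')
  then show ?case by (simp add: pderiv_p_add algebra_simps)
next
  case (monomial m c)
  show ?case
  proof (induction g rule: symfun_induct)
    case (add g g')
    then show ?case by (simp add: pderiv_p_add algebra_simps)
  next
    case (monomial m' c')
    let ?e = "Poly_Mapping.single (n - 1) (1::nat)"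
    \<comment> \<open>Subtraction of exponents is truncated; where this matters the coefficient vanishes.\<close>
    have left: "m + m' - ?e = m - ?e + m'" if "Poly_Mapping.lookup m (n - 1) > 0" for m m' :: "nat \<Rightarrow>\<^sub>0 nat"
      using that by (intro poly_mapping_eqI) (auto simp: lookup_minus lookup_add lookup_single when_def)
    have 1: "Poly_Mapping.single (m - ?e + m') (of_nat (Poly_Mapping.lookup m (n - 1)) * (c * c')) =
        Poly_Mapping.single (m + m' - ?e) (of_nat (Poly_Mapping.lookup m (n - 1)) * (c * c'))"
      using left[of m m'] by (cases "Poly_Mapping.lookup m (n - 1) = 0") auto
    have 2: "Poly_Mapping.single (m + (m' - ?e)) (of_nat (Poly_Mapping.lookup m' (n - 1)) * (c * c')) =
        Poly_Mapping.single (m + m' - ?e) (of_nat (Poly_Mapping.lookup m' (n - 1)) * (c * c'))"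
      using left[of m' m] by (cases "Poly_Mapping.lookup m' (n - 1) = 0") (auto simp: add.commute)
    have 3: "c * (of_nat k * c') = of_nat k * (c * c')" for k
      by (simp add: algebra_simps)
    show ?case
      by (simp only: mult_single pderiv_p_monomial mult.assoc 1 2 3)
        (simp add: lookup_add distrib_right flip: single_add)
  qed
qed

lemma pderiv_p_const: "pderiv_p n (Poly_Mapping.single 0 c) = 0"
  by (simp add: pderiv_p_monomial)

lemma linear_op_pderiv_p: "linear_op (pderiv_p n)"
  by (rule linear_opI) (simp_all add: pderiv_p_add scal_def pderiv_p_mult pderiv_p_const)

lemma pderiv_p_commute: "pderiv_p r (pderiv_p s f) = pderiv_p s (pderiv_p r f)"
proof (induction f rule: symfun_induct)
  case (monomial m c)
  have "m - Poly_Mapping.single i 1 - Poly_Mapping.single j 1 =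
      m - Poly_Mapping.single j 1 - Poly_Mapping.single i (1::nat)" for i j
    by (intro poly_mapping_eqI) (simp add: lookup_minus)
  from this[of "r - 1" "s - 1"] show ?case
    by (cases "r - 1 = s - 1") (simp_all add: pderiv_p_monomial lookup_minus lookup_single mult_ac)
qed (simp add: pderiv_p_add)

lemma pderiv_p_psum: "r > 0 \<Longrightarrow> n > 0 \<Longrightarrow> pderiv_p r (psum n) = of_bool (r = n)"
  by (auto simp: psum_def pderiv_p_monomial lookup_single when_def)

text \<open>The coefficient of \<open>w\<^sup>m\<close> in the ring homomorphism that sends every \<open>p\<^sub>n\<close> to \<open>p\<^sub>n + a\<^sub>n w\<^sup>n\<close>
  (\<open>shift_mult\<close> and \<open>shift_psum\<close> below). Both lowering exponentials of the theorem have this form: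
  \<open>a\<^sub>n = -1\<close> in the definition of \<open>S\<^sub>n\<close>, and \<open>a\<^sub>n = 1 - t\<^sup>n\<close> in that of \<open>q\<^sub>n\<^sup>*\<close>.\<close>
definition shift_psums :: "(nat \<Rightarrow> ratfun) \<Rightarrow> nat \<Rightarrow> symfun \<Rightarrow> symfun" where
  "shift_psums a = op_exp (\<lambda>r g. scal (a r) (pderiv_p r g))"

lemma linear_op_scal_pderiv_p: "linear_op (\<lambda>g. scal c (pderiv_p r g))"
  by (rule linear_opI)
    (simp_all add: linear_op_add[OF linear_op_pderiv_p] linear_op_scal[OF linear_op_pderiv_p]
      symfun.scale_right_distrib mult.commute)

lemma scal_pderiv_p_commute:
  "scal c (pderiv_p r (scal d (pderiv_p s f))) = scal d (pderiv_p s (scal c (pderiv_p r f)))"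
  by (simp add: linear_op_scal[OF linear_op_pderiv_p] pderiv_p_commute[of r] mult.commute)

lemma linear_op_shift: "linear_op (shift_psums a m)"
  unfolding shift_psums_def by (rule linear_op_op_exp) (rule linear_op_scal_pderiv_p)

lemma shift_recursion:
  "of_nat m * shift_psums a m f = (\<Sum>r=1..m. of_nat r * scal (a r) (pderiv_p r (shift_psums a (m - r) f)))"
  unfolding shift_psums_def
  by (intro op_exp_recursion linear_op_scal_pderiv_p scal_pderiv_p_commute)

lemma shift_0: "shift_psums a 0 f = f"
  by (simp add: shift_psums_def op_exp_0)

lemma shift_commute: "shift_psums a m (shift_psums b n f) = shift_psums b n (shift_psums a m f)"
  unfolding shift_psums_def
  by (intro op_exp_commute linear_op_scal_pderiv_p scal_pderiv_p_commute)

lemma shift_mult: "shift_psums a m (f * g) = (\<Sum>i\<le>m. shift_psums a i f * shift_psums a (m - i) g)"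
  unfolding shift_psums_def
  by (intro op_exp_mult linear_op_scal_pderiv_p scal_pderiv_p_commute)
    (simp add: pderiv_p_mult symfun.scale_right_distrib scal_mult_left scal_mult_right)

lemma shift_const: "shift_psums a m (Poly_Mapping.single 0 c) = (if m = 0 then Poly_Mapping.single 0 c else 0)"
proof (induction m rule: less_induct)
  case (less m)
  show ?case
  proof (cases "m = 0")
    case False
    have "of_nat m * shift_psums a m (Poly_Mapping.single 0 c) = 0"
      unfolding shift_recursion using less
      by (intro sum.neutral ballI) (simp add: pderiv_p_const linear_op_zero[OF linear_op_pderiv_p])
    then show ?thesis using False by simp
  qed (simp add: shift_0)
qed

lemma shift_one: "shift_psums a m 1 = of_bool (m = 0)"
  using shift_const[of a m 1] by simp

lemma shift_psum:
  assumes "n > 0"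
  shows "shift_psums a m (psum n) = (if m = 0 then psum n else if m = n then scal (a n) 1 else 0)"
proof (induction m rule: less_induct)
  case (less m)
  have "pderiv_p r (scal c 1) = 0" for r c
    by (simp add: scal_def pderiv_p_const)
  note simps = this linear_op_zero[OF linear_op_pderiv_p] pderiv_p_psum[OF _ assms]
  show ?case
  proof (cases "m = 0")
    case False
    have "of_nat m * shift_psums a m (psum n) = (\<Sum>r=1..m. if r = m then of_bool (m = n) * of_nat m * scal (a m) 1 else 0)"
      unfolding shift_recursion using less assms
      by (intro sum.cong refl) (auto simp: simps)
    also have "\<dots> = of_nat m * (if m = n then scal (a n) 1 else 0)"
      using False by simp
    finally show ?thesis using False by simp
  qed (simp add: shift_0)
qed

text \<open>Only the two nonzero coefficients of the image of \<open>p\<^sub>n\<close> contribute to the product.\<close>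
lemma shift_psum_mult:
  assumes "n > 0"
  shows "shift_psums a m (psum n * g) =
    psum n * shift_psums a m g + (if n \<le> m then scal (a n) (shift_psums a (m - n) g) else 0)"
proof -
  have "shift_psums a m (psum n * g) =
      (\<Sum>i\<le>m. (if i = 0 then psum n * shift_psums a m g else 0) +
        (if i = n then scal (a n) (shift_psums a (m - n) g) else 0))"
    unfolding shift_mult shift_psum[OF assms] using assms
    by (intro sum.cong refl) (auto simp: scal_mult_left)
  also have "\<dots> = psum n * shift_psums a m g + (if n \<le> m then scal (a n) (shift_psums a (m - n) g) else 0)"
    by (simp add: sum.distrib)
  finally show ?thesis .
qed

text \<open>The functions whose image is a polynomial in \<open>w\<close> form a subring, which contains the constants
  and the \<open>p\<^sub>n\<close>, hence everything. This makes the infinite sums in \<open>S\<^sub>n\<close> finite.\<close>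
lemma shift_eventually_zero: "\<exists>N. \<forall>i\<ge>N. shift_psums a i f = 0"
proof -
  let ?V = "\<lambda>f. \<exists>N. \<forall>i\<ge>N. shift_psums a i f = 0"
  have mult: "?V (f * g)" if fg: "?V f" "?V g" for f g
  proof -
    obtain N N' where N: "\<forall>i\<ge>N. shift_psums a i f = 0" "\<forall>i\<ge>N'. shift_psums a i g = 0"
      using fg by auto
    have "shift_psums a i (f * g) = 0" if "i \<ge> N + N'" for i
      unfolding shift_mult
    proof (intro sum.neutral ballI)
      fix j assume "j \<in> {..i}"
      have "j \<ge> N \<or> i - j \<ge> N'" using that by linarith
      then show "shift_psums a j f * shift_psums a (i - j) g = 0" using N by auto
    qed
    then show ?thesis by blast
  qed
  have const: "?V (Poly_Mapping.single 0 c)" for c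
    by (rule exI[of _ 1]) (simp add: shift_const)
  have psum: "?V (psum n)" if "n > 0" for n
    using that by (intro exI[of _ "Suc n"]) (simp add: shift_psum)
  have power: "?V (psum n ^ b)" if "n > 0" for n b
  proof (induction b)
    case 0
    show ?case using const[of 1] by simp
  qed (use mult psum that in auto)
  have psum_power: "psum (Suc k) ^ b = Poly_Mapping.single (Poly_Mapping.single k b) 1" for k b
    by (induction b) (simp_all add: psum_def mult_single flip: single_add)
  have mono: "?V (Poly_Mapping.single m c)" for m c
  proof (induction m rule: Poly_Mapping.update_induct)
    case const
    show ?case by (rule \<open>?V (Poly_Mapping.single 0 c)\<close>)
  next
    case (update m k b)
    have "Poly_Mapping.update k b m = m + Poly_Mapping.single k b"
      using update by (intro poly_mapping_eqI)
        (auto simp: lookup_update lookup_add lookup_single when_def in_keys_iff)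
    then have "Poly_Mapping.single (Poly_Mapping.update k b m) c = Poly_Mapping.single m c * psum (Suc k) ^ b"
      by (simp add: psum_power mult_single)
    then show ?case using mult[OF update.IH power[of "Suc k" b]] by simp
  qed
  show ?thesis
  proof (induction f rule: symfun_induct)
    case (monomial m c)
    show ?case by (rule mono)
  next
    case (add f g)
    then obtain N N' where "\<forall>i\<ge>N. shift_psums a i f = 0" "\<forall>i\<ge>N'. shift_psums a i g = 0"
      by auto
    then show ?case
      by (intro exI[of _ "max N N'"]) (simp add: linear_op_add[OF linear_op_shift])
  qed
qed

text \<open>The complete homogeneous symmetric functions. The index is an integer, with value \<open>0\<close> below
  \<open>0\<close>, so that sums over shifted indices need no side conditions.\<close>
definition hsym :: "int \<Rightarrow> symfun" where
  "hsym n = (if n \<ge> 0 then op_exp (\<lambda>r g. scal (1 / of_nat r) (psum r * g)) (nat n) 1 else 0)"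

lemma hsym_neg: "n < 0 \<Longrightarrow> hsym n = 0"
  and hsym_0: "hsym 0 = 1"
  by (simp_all add: hsym_def op_exp_0)

lemma linear_op_mult_psum: "linear_op (\<lambda>g. scal c (psum r * g))"
  by (rule linear_opI) (simp_all add: scal_def algebra_simps)

lemma mult_psum_commute: "scal c (psum r * scal d (psum s * g)) = scal d (psum s * scal c (psum r * g))"
  by (simp add: scal_def algebra_simps)

lemma op_exp_psum_eq_hsym:
  assumes "n \<ge> 0"
  shows "op_exp (\<lambda>r g. scal (1 / of_nat r) (psum r * g)) (nat n) f = hsym n * f"
proof -
  have "linear_op (\<lambda>g. g * f)"
    by (rule linear_opI) (simp_all add: scal_mult_left distrib_right)
  then have "op_exp (\<lambda>r g. scal (1 / of_nat r) (psum r * g)) (nat n) (1 * f) =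
      op_exp (\<lambda>r g. scal (1 / of_nat r) (psum r * g)) (nat n) 1 * f"
    by (intro op_exp_commute_op linear_op_mult_psum mult_psum_commute)
      (simp_all add: scal_mult_left mult.assoc)
  then show ?thesis using assms by (simp add: hsym_def)
qed

text \<open>Newton's identity \<open>n h\<^sub>n = \<Sum>p\<^sub>r h\<^sub>n\<^sub>-\<^sub>r\<close>. Any upper bound \<open>R \<ge> n\<close> for \<open>r\<close> will do, as \<open>h\<close> vanishes at negative
  indices; this freedom is used to compare recursions for different \<open>n\<close>.\<close>
lemma hsym_recursion:
  assumes "n \<le> int R"
  shows "of_int n * hsym n = (\<Sum>r=1..R. psum r * hsym (n - int r))"
proof (cases "n \<ge> 0")
  case True
  define m where "m = nat n"
  have n: "n = int m" using True by (simp add: m_def)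
  have "of_nat m * hsym n = (\<Sum>r=1..m. of_nat r * scal (1 / of_nat r) (psum r * hsym (n - int r)))"
    unfolding n hsym_def by (simp add: op_exp_recursion[OF linear_op_mult_psum mult_psum_commute] nat_diff_distrib')
  also have "\<dots> = (\<Sum>r=1..m. psum r * hsym (n - int r))"
    by (intro sum.cong refl) (simp flip: scal_of_nat)
  also have "\<dots> = (\<Sum>r=1..R. psum r * hsym (n - int r))"
    using assms by (intro sum.mono_neutral_left) (auto simp: n hsym_neg)
  finally show ?thesis by (simp add: n)
qed (simp add: hsym_neg)

text \<open>The homomorphism multiplies \<open>\<Sum>h\<^sub>n z\<^sup>n = exp (\<Sum>p\<^sub>n z\<^sup>n / n)\<close> by the scalar series
  \<open>exp (\<Sum>a\<^sub>n (zw)\<^sup>n / n) = \<Sum>c\<^sub>j (zw)\<^sup>j\<close>. The hypotheses on \<open>c\<close> are the differential equation of the latter;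
  in this form they are easy to verify for a guessed \<open>c\<close>.\<close>
lemma shift_hsym:
  assumes c0: "c 0 = 1" and c: "\<And>j. of_nat j * c j = (\<Sum>r=1..j. a r * c (j - r))"
  shows "shift_psums a j (hsym n) = scal (c j) (hsym (n - int j))"
proof (cases "n \<ge> 0")
  case True
  then obtain m where "n = int m" using nonneg_int_cases by auto
  moreover have "shift_psums a j (hsym (int m)) = scal (c j) (hsym (int m - int j))"
  proof (induction m arbitrary: j rule: less_induct)
    case (less m)
    show ?case
    proof (cases "m = 0")
      case True
      then show ?thesis
        by (cases "j = 0") (simp_all add: shift_0 c0 hsym_0 shift_one hsym_neg)
    next
      case False
      let ?h = "hsym (int m - int j)"
      have "of_nat m * shift_psums a j (hsym (int m)) =
          (\<Sum>r=1..m. shift_psums a j (psum r * hsym (int m - int r)))"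
        using hsym_recursion[of "int m" m]
        by (simp flip: linear_op_sum[OF linear_op_shift] linear_op_of_nat[OF linear_op_shift])
      also have "\<dots> = (\<Sum>r=1..m. scal (c j) (psum r * hsym (int m - int j - int r)) +
          (if r \<le> j then scal (a r * c (j - r)) ?h else 0))"
      proof (intro sum.cong refl)
        fix r assume r: "r \<in> {1..m}"
        then have "int m - int r = int (m - r)" and "m - r < m" by auto
        then have IH: "shift_psums a i (hsym (int m - int r)) = scal (c i) (hsym (int m - int r - int i))" for i
          using less[of "m - r" i] by (simp only:)
        have [simp]: "int m - int r - int (j - r) = int m - int j" if "r \<le> j"
          using that by simp
        have [simp]: "int m - int r - int j = int m - int j - int r" by simp
        show "shift_psums a j (psum r * hsym (int m - int r)) =
            scal (c j) (psum r * hsym (int m - int j - int r)) +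
            (if r \<le> j then scal (a r * c (j - r)) ?h else 0)"
          using r by (simp add: shift_psum_mult IH scal_mult_right)
      qed
      also have "\<dots> = scal (c j) (of_int (int m - int j) * ?h) +
          (\<Sum>r=1..m. if r \<le> j then scal (a r * c (j - r)) ?h else 0)"
        using hsym_recursion[of "int m - int j" m]
        by (simp add: sum.distrib symfun.scale_sum_right)
      also have "(\<Sum>r=1..m. if r \<le> j then scal (a r * c (j - r)) ?h else 0) = scal (of_nat j * c j) ?h"
      proof (cases "j \<le> m")
        case True
        have "(\<Sum>r=1..m. if r \<le> j then scal (a r * c (j - r)) ?h else 0) = (\<Sum>r=1..j. scal (a r * c (j - r)) ?h)"
          using True by (intro sum.mono_neutral_cong_right) auto
        then show ?thesis by (simp add: c symfun.scale_sum_left)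
      qed (simp add: hsym_neg)
      also have "scal (c j) (of_int (int m - int j) * ?h) + scal (of_nat j * c j) ?h =
          of_nat m * scal (c j) ?h"
      proof -
        have "scal (of_nat j * c j) ?h = of_nat j * scal (c j) ?h"
          by (simp flip: scal_of_nat)
        then show ?thesis
          by (simp add: scal_mult_right left_diff_distrib symfun.scale_right_diff_distrib)
      qed
      finally show ?thesis using False by simp
    qed
  qed
  ultimately show ?thesis by simp
qed (simp add: hsym_neg linear_op_zero[OF linear_op_shift])

lemma shift_hsym_mult:
  assumes "c 0 = 1" and "\<And>j. of_nat j * c j = (\<Sum>r=1..j. a r * c (j - r))"
  shows "shift_psums a j (hsym n * g) = (\<Sum>i\<le>j. scal (c i) (hsym (n - int i) * shift_psums a (j - i) g))"
  unfolding shift_mult shift_hsym[of c a, OF assms] scal_mult_left ..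

section \<open>Commutation relations of the vertex operators\<close>

abbreviation "lower \<equiv> shift_psums (\<lambda>_. -1)"

lemma S_op_eq_sum:
  assumes "\<forall>i\<ge>N. lower i f = 0"
  shows "S_op n f = (\<Sum>i<N. hsym (n + int i) * lower i f)"
proof -
  have "op_exp (\<lambda>r g. - pderiv_p r g) = lower"
    by (simp add: shift_psums_def)
  then have "S_op n f = Sum_any (\<lambda>i. hsym (n + int i) * lower i f)"
    unfolding S_op_def
    by (intro arg_cong[where f = Sum_any] ext) (simp add: op_exp_psum_eq_hsym hsym_neg)
  also have "\<dots> = (\<Sum>i<N. hsym (n + int i) * lower i f)"
    using assms by (intro Sum_any.expand_superset) (auto simp: not_le)
  finally show ?thesis .
qed

lemma linear_op_S_op: "linear_op (S_op n)"
proof (rule linear_opI)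
  fix f g c
  obtain N1 N2 where N: "\<forall>i\<ge>N1. lower i f = 0" "\<forall>i\<ge>N2. lower i g = 0"
    using shift_eventually_zero by metis
  define N where "N = max N1 N2"
  have zero: "\<forall>i\<ge>N. lower i f = 0" "\<forall>i\<ge>N. lower i g = 0"
    using N by (simp_all add: N_def)
  then have "\<forall>i\<ge>N. lower i (f + g) = 0" "\<forall>i\<ge>N. lower i (scal c f) = 0"
    by (simp_all add: linear_op_add[OF linear_op_shift] linear_op_scal[OF linear_op_shift])
  with zero show "S_op n (f + g) = S_op n f + S_op n g" "S_op n (scal c f) = scal c (S_op n f)"
    by (simp_all add: S_op_eq_sum[of N] linear_op_add[OF linear_op_shift]
        linear_op_scal[OF linear_op_shift] distrib_left sum.distrib scal_mult_right symfun.scale_sum_right)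
qed

lemma S_op_one: "S_op n 1 = hsym n"
  by (subst S_op_eq_sum[of 1]) (simp_all add: shift_one)

text \<open>The homomorphism commutes with the lowering exponential in \<open>S\<^sub>n\<close> and multiplies the raising
  one by a scalar series, so it commutes with \<open>\<Sum>S\<^sub>n z\<^sup>n\<close> up to this series.\<close>
lemma shift_S_op:
  assumes c: "c 0 = 1" "\<And>j. of_nat j * c j = (\<Sum>r=1..j. a r * c (j - r))"
  shows "shift_psums a k (S_op n f) =
    (\<Sum>j\<le>k. scal (c j) (S_op (n - int j) (shift_psums a (k - j) f)))"
proof -
  obtain N where N: "\<forall>i\<ge>N. lower i f = 0"
    using shift_eventually_zero by metis
  have N': "\<forall>i\<ge>N. lower i (shift_psums a j f) = 0" for j
    using N by (simp add: shift_commute[of "\<lambda>_. -1"] linear_op_zero[OF linear_op_shift])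
  have "shift_psums a k (S_op n f) = (\<Sum>i<N. \<Sum>j\<le>k.
      scal (c j) (hsym (n + int i - int j) * shift_psums a (k - j) (lower i f)))"
    by (simp add: S_op_eq_sum[OF N] linear_op_sum[OF linear_op_shift] shift_hsym_mult[of c a, OF c])
  also have "\<dots> = (\<Sum>j\<le>k. scal (c j) (\<Sum>i<N. hsym (n - int j + int i) * lower i (shift_psums a (k - j) f)))"
    by (subst sum.swap) (simp add: symfun.scale_sum_right shift_commute[of a] algebra_simps)
  also have "\<dots> = (\<Sum>j\<le>k. scal (c j) (S_op (n - int j) (shift_psums a (k - j) f)))"
    by (simp add: S_op_eq_sum[OF N'])
  finally show ?thesis .
qed

text \<open>The coefficients of \<open>exp (- \<Sum>u\<^sup>n / n) = 1 - u\<close>.\<close>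
definition lower_coeff :: "nat \<Rightarrow> ratfun" where
  "lower_coeff j = (if j = 0 then 1 else if j = 1 then -1 else 0)"

lemma lower_coeff_recursion: "of_nat j * lower_coeff j = (\<Sum>r=1..j. -1 * lower_coeff (j - r))"
proof -
  consider "j = 0" | "j = 1" | i where "j = Suc (Suc i)"
    by (cases j; cases "j - 1") auto
  then show ?thesis
  proof cases
    case 3
    have "(\<Sum>r=1..i. -1 * lower_coeff (j - r)) = 0"
      using 3 by (intro sum.neutral) (auto simp: lower_coeff_def)
    with 3 show ?thesis by (simp add: lower_coeff_def)
  qed (simp_all add: lower_coeff_def)
qed

lemma lower_hsym_mult:
  "lower i (hsym n * g) = hsym n * lower i g - (if i = 0 then 0 else hsym (n - 1) * lower (i - 1) g)"
proof -
  have "lower i (hsym n * g) = (\<Sum>j\<le>i. scal (lower_coeff j) (hsym (n - int j) * lower (i - j) g))"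
    by (rule shift_hsym_mult) (simp add: lower_coeff_def, rule lower_coeff_recursion)
  also have "\<dots> = (\<Sum>j\<le>i. (if j = 0 then hsym n * lower i g else 0) +
      (if j = 1 then - (hsym (n - 1) * lower (i - 1) g) else 0))"
    by (intro sum.cong refl) (simp add: lower_coeff_def)
  also have "\<dots> = hsym n * lower i g - (if i = 0 then 0 else hsym (n - 1) * lower (i - 1) g)"
    by (simp add: sum.distrib)
  finally show ?thesis .
qed

text \<open>By \<open>lower_hsym_mult\<close>, moving all raising parts to the left gives
  \<open>S\<^sub>x S\<^sub>y = T x y - T (x + 1) (y - 1)\<close>, where \<open>T x y = \<Sum>h\<^sub>x\<^sub>+\<^sub>i h\<^sub>y\<^sub>+\<^sub>j L\<^sub>i L\<^sub>j\<close> with the coefficients \<open>L\<^sub>i\<close> of the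
  lowering exponential. Since \<open>T\<close> is symmetric, passing from \<open>(x, y)\<close> to \<open>(y - 1, x + 1)\<close> exchanges
  the two terms.\<close>
lemma S_op_anticommute: "S_op a (S_op b f) = - S_op (b - 1) (S_op (a + 1) f)"
proof -
  obtain N where N: "\<forall>i\<ge>N. lower i f = 0"
    using shift_eventually_zero by metis
  define T where "T x y = (\<Sum>i<N. \<Sum>j<N. hsym (x + int i) * (hsym (y + int j) * lower i (lower j f)))" for x y
  have zero: "lower i (lower j f) = 0" if "i \<ge> N" for i j
    using that N shift_commute[of "\<lambda>_. -1" i] by (simp add: linear_op_zero[OF linear_op_shift])
  have T_sym: "T x y = T y x" for x y
    unfolding T_def
    by (subst sum.swap) (simp add: mult_ac shift_commute[of "\<lambda>_. -1" _ "\<lambda>_. -1"])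
  have lower_S: "lower i (S_op y f) = (\<Sum>j<N. hsym (y + int j) * lower i (lower j f)) -
      (if i = 0 then 0 else \<Sum>j<N. hsym (y - 1 + int j) * lower (i - 1) (lower j f))" for i y
    by (simp add: S_op_eq_sum[OF N] linear_op_sum[OF linear_op_shift] lower_hsym_mult sum_subtractf
        algebra_simps)
  \<comment> \<open>One more term than for \<open>f\<close>: the second sum in \<open>lower_S\<close> is shifted by one.\<close>
  have "\<forall>i\<ge>Suc N. lower i (S_op y f) = 0" for y
    by (auto simp: lower_S zero)
  from S_op_eq_sum[OF this]
  have SS: "S_op x (S_op y f) = (\<Sum>i<Suc N. hsym (x + int i) * lower i (S_op y f))" for x y .
  have S: "S_op x (S_op y f) = T x y - T (x + 1) (y - 1)" for x y
  proof -
    have "S_op x (S_op y f) =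
        (\<Sum>i<Suc N. hsym (x + int i) * (\<Sum>j<N. hsym (y + int j) * lower i (lower j f))) -
        (\<Sum>i<Suc N. if i = 0 then 0 else
          hsym (x + int i) * (\<Sum>j<N. hsym (y - 1 + int j) * lower (i - 1) (lower j f)))"
      unfolding SS lower_S right_diff_distrib sum_subtractf
      by (intro arg_cong2[where f = minus] sum.cong refl) auto
    also have "(\<Sum>i<Suc N. hsym (x + int i) * (\<Sum>j<N. hsym (y + int j) * lower i (lower j f))) = T x y"
      by (simp add: T_def zero sum_distrib_left)
    also have "(\<Sum>i<Suc N. if i = 0 then 0 else
        hsym (x + int i) * (\<Sum>j<N. hsym (y - 1 + int j) * lower (i - 1) (lower j f))) = T (x + 1) (y - 1)"
      by (subst sum.lessThan_Suc_shift) (simp add: T_def sum_distrib_left add_ac)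
    finally show ?thesis .
  qed
  have "S_op (b - 1) (S_op (a + 1) f) = T (a + 1) (b - 1) - T a b"
    unfolding S by (simp add: T_sym[of "b - 1"] T_sym[of b])
  then show ?thesis by (simp add: S)
qed

lemma S_op_repeat_eq_0: "S_op (x - 1) (S_op x f) = 0"
  using S_op_anticommute[of "x - 1" x f] by (simp add: eq_neg_iff_add_eq_0 flip: mult_2)

text \<open>The coefficients of \<open>exp (\<Sum>(1 - t\<^sup>n) u\<^sup>n / n) = (1 - t u) / (1 - u)\<close>, continued by zero to negative
  indices. They are also \<open>1 - t\<close> times the entries of the matrix in the theorem.\<close>
definition q_coeff :: "int \<Rightarrow> ratfun" where
  "q_coeff m = (if m < 0 then 0 else if m = 0 then 1 else 1 - tvar)"

lemma q_coeff_recursion: "of_nat j * q_coeff (int j) = (\<Sum>r=1..j. (1 - tvar ^ r) * q_coeff (int (j - r)))"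
proof (cases j)
  case (Suc i)
  have geom: "(\<Sum>r=1..i. (1 - tvar ^ r) * (1 - tvar)) = of_nat i * (1 - tvar) - tvar + tvar ^ Suc i"
    by (induction i) (simp_all add: algebra_simps)
  have "(\<Sum>r=1..i. (1 - tvar ^ r) * q_coeff (int (j - r))) = (\<Sum>r=1..i. (1 - tvar ^ r) * (1 - tvar))"
    using Suc by (intro sum.cong refl) (auto simp: q_coeff_def)
  with Suc geom show ?thesis
    by (simp add: q_coeff_def algebra_simps)
qed (simp add: q_coeff_def)

lemma q_star_eq_shift: "q_star = shift_psums (\<lambda>r. 1 - tvar ^ r)"
  by (simp add: q_star_def shift_psums_def)

lemma q_star_S_op:
  "q_star k (S_op n f) = (\<Sum>j\<le>k. scal (q_coeff (int j)) (S_op (n - int j) (q_star (k - j) f)))"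
  unfolding q_star_eq_shift
  by (rule shift_S_op[where c = "\<lambda>j. q_coeff (int j)"]) (simp add: q_coeff_def, rule q_coeff_recursion)

lemma q_star_one: "q_star k 1 = of_bool (k = 0)"
  unfolding q_star_eq_shift by (rule shift_one)

section \<open>Straightening and expansion in alternants\<close>

definition desc :: "int set \<Rightarrow> int list" where
  "desc A = rev (sorted_list_of_set A)"

lemma desc_unique: "sorted_wrt (>) xs \<Longrightarrow> desc (set xs) = xs"
  using strict_sorted_equal[of "rev xs" "sorted_list_of_set (set xs)"]
  by (simp add: desc_def sorted_wrt_rev)

lemma sorted_desc: "sorted_wrt (>) (desc A)"
  by (simp add: desc_def sorted_wrt_rev)

lemma set_desc: "finite A \<Longrightarrow> set (desc A) = A"
  by (simp add: desc_def)

lemma length_desc: "length (desc A) = card A"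
  by (simp add: desc_def)

lemma distinct_desc: "distinct (desc A)"
  by (simp add: desc_def)

text \<open>For \<open>u\<^sub>i = \<lambda>\<^sub>i - i\<close> the straightening rule \<open>S\<^sub>a S\<^sub>b = - S\<^sub>b\<^sub>-\<^sub>1 S\<^sub>a\<^sub>+\<^sub>1\<close> becomes a plain exchange of neighbours.
  Therefore products of the \<open>S\<^sub>n\<close> are indexed by the \<open>u\<^sub>i\<close>; the argument \<open>p\<close> is the position of the
  first entry, which has to be added back.\<close>
primrec S_seq :: "int \<Rightarrow> int list \<Rightarrow> symfun" where
  "S_seq p [] = 1"
| "S_seq p (x # xs) = S_op (x + p) (S_seq (p + 1) xs)"

lemma S_seq_swap: "S_seq p (x # y # zs) = - S_seq p (y # x # zs)"
  using S_op_anticommute[of "x + p" "y + p + 1" "S_seq (p + 2) zs"] by (simp add: add_ac)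

lemma S_seq_repeat: "S_seq p (x # x # zs) = 0"
  using S_op_repeat_eq_0[of "x + p + 1" "S_seq (p + 2) zs"] by (simp add: add_ac)

text \<open>Insertion sort: each exchange with a larger entry changes the sign, and meeting an equal
  entry gives zero.\<close>
lemma S_seq_insert:
  assumes "sorted_wrt (>) xs"
  shows "S_seq p (x # xs) = (if x \<in> set xs then 0
    else scal ((-1) ^ card {y \<in> set xs. y > x}) (S_seq p (desc (insert x (set xs)))))"
  using assms
proof (induction xs arbitrary: p)
  case Nil
  show ?case using desc_unique[of "[x]"] by simp
next
  case (Cons y ys)
  consider "x > y" | "x = y" | "x < y" by linarith
  then show ?case
  proof cases
    case 1
    then have "sorted_wrt (>) (x # y # ys)" using Cons.prems by auto
    then have "desc (insert x (set (y # ys))) = x # y # ys"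
      using desc_unique[of "x # y # ys"] by simp
    moreover have "{z \<in> set (y # ys). z > x} = {}" "x \<notin> set (y # ys)"
      using Cons.prems 1 by auto
    ultimately show ?thesis by (simp only: card.empty) simp
  next
    case 2
    then show ?thesis by (simp add: S_seq_repeat del: S_seq.simps)
  next
    case 3
    let ?A = "insert x (set ys)" and ?m = "card {z \<in> set ys. z > x}"
    have "sorted_wrt (>) (y # desc ?A)"
      using Cons.prems 3 by (auto simp: sorted_desc set_desc)
    then have desc: "desc (insert x (set (y # ys))) = y # desc ?A"
      using desc_unique[of "y # desc ?A"] by (simp add: set_desc insert_commute)
    have "y \<notin> set ys" using Cons.prems by auto
    moreover have "{z \<in> set (y # ys). z > x} = insert y {z \<in> set ys. z > x}"
      using 3 by auto
    ultimately have card: "card {z \<in> set (y # ys). z > x} = Suc ?m" by simp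
    have IH: "S_seq (p + 1) (x # ys) =
        (if x \<in> set ys then 0 else scal ((-1) ^ ?m) (S_seq (p + 1) (desc ?A)))"
      using Cons.IH Cons.prems by (simp only: sorted_wrt.simps)
    have "S_seq p (x # y # ys) = - S_op (y + p) (S_seq (p + 1) (x # ys))"
      by (simp only: S_seq_swap[of p x] S_seq.simps(2)[of p y])
    also have "\<dots> = (if x \<in> set ys then 0 else - scal ((-1) ^ ?m) (S_seq p (y # desc ?A)))"
      unfolding IH by (simp add: linear_op_zero[OF linear_op_S_op] linear_op_scal[OF linear_op_S_op])
    finally show ?thesis
      using 3 unfolding desc card by simp
  qed
qed

text \<open>Coefficients are indexed by finite sets of integers, each standing for its decreasing
  enumeration. This makes it possible to expand determinants along the first row without renumbering
  columns.\<close>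
definition alternant :: "('b \<Rightarrow> int \<Rightarrow> 'a::comm_ring_1) \<Rightarrow> 'b list \<Rightarrow> int set \<Rightarrow> 'a" where
  "alternant f vs A = det (mat (length vs) (length vs) (\<lambda>(i, j). f (vs ! i) (desc A ! j)))"

text \<open>Laplace expansion along the first row. The column of \<open>x\<close> has as many columns to its left as
  there are larger elements of \<open>A\<close>, whence the sign; the same sign arises when \<open>x\<close> is inserted in
  \<open>A - {x}\<close> by \<open>S_seq_insert\<close>.\<close>
lemma alternant_Cons:
  assumes "finite A" and "card A = Suc (length vs)"
  shows "alternant f (v # vs) A =
    (\<Sum>x\<in>A. (-1) ^ card {y \<in> A. y > x} * f v x * alternant f vs (A - {x}))"
proof -
  define n where "n = length vs"
  define xs where "xs = desc A"
  define M where "M = mat (Suc n) (Suc n) (\<lambda>(i, j). f ((v # vs) ! i) (xs ! j))"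
  have xs: "length xs = Suc n" "set xs = A" "sorted_wrt (>) xs" "distinct xs"
    using assms by (simp_all add: xs_def n_def length_desc set_desc sorted_desc distinct_desc)
  have M: "M \<in> carrier_mat (Suc n) (Suc n)" by (simp add: M_def)
  have "alternant f (v # vs) A = (\<Sum>j<Suc n. M $$ (0, j) * cofactor M 0 j)"
    using laplace_expansion_row[OF M, of 0] by (simp add: alternant_def M_def n_def xs_def)
  also have "\<dots> = (\<Sum>j<Suc n. (-1) ^ card {y \<in> A. y > xs ! j} * f v (xs ! j) * alternant f vs (A - {xs ! j}))"
  proof (intro sum.cong refl)
    fix j assume "j \<in> {..<Suc n}"
    then have j: "j < length xs" using xs by simp
    have "{y \<in> A. y > xs ! j} = (!) xs ` {..<j}"
    proof (intro equalityI subsetI)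
      fix y assume "y \<in> {y \<in> A. y > xs ! j}"
      then obtain i where i: "i < length xs" "y = xs ! i" "xs ! i > xs ! j"
        using xs(2) by (auto simp: in_set_conv_nth)
      then have "\<not> j < i" "i \<noteq> j"
        using sorted_wrt_nth_less[OF xs(3), of j i] by auto
      then show "y \<in> (!) xs ` {..<j}" using i by auto
    next
      fix y assume "y \<in> (!) xs ` {..<j}"
      then show "y \<in> {y \<in> A. y > xs ! j}"
        using j xs sorted_wrt_nth_less[OF xs(3)] by (auto intro: nth_mem)
    qed
    then have card: "card {y \<in> A. y > xs ! j} = j"
      using j xs(4) by (simp add: card_image inj_on_nth)
    let ?ys = "take j xs @ drop (Suc j) xs"
    have decomp: "xs = take j xs @ xs ! j # drop (Suc j) xs"
      using j by (simp add: id_take_nth_drop)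
    have "sorted_wrt (>) (take j xs @ xs ! j # drop (Suc j) xs)" "distinct (take j xs @ xs ! j # drop (Suc j) xs)"
      using xs decomp by simp_all
    moreover have "A = set (take j xs @ xs ! j # drop (Suc j) xs)"
      using xs decomp by simp
    ultimately have "sorted_wrt (>) ?ys" "set ?ys = A - {xs ! j}"
      by (auto simp: sorted_wrt_append)
    then have "desc (A - {xs ! j}) = ?ys"
      using desc_unique by metis
    then have "mat_delete M 0 j = mat n n (\<lambda>(i, i'). f (vs ! i) (desc (A - {xs ! j}) ! i'))"
      using j xs(1) by (intro eq_matI) (auto simp: mat_delete_def M_def nth_append)
    then have "cofactor M 0 j = (-1) ^ j * alternant f vs (A - {xs ! j})"
      by (simp add: cofactor_def alternant_def n_def)
    moreover have "M $$ (0, j) = f v (xs ! j)"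
      using j xs(1) by (simp add: M_def)
    ultimately show "M $$ (0, j) * cofactor M 0 j =
        (-1) ^ card {y \<in> A. y > xs ! j} * f v (xs ! j) * alternant f vs (A - {xs ! j})"
      unfolding card by simp
  qed
  also have "\<dots> = (\<Sum>x\<in>A. (-1) ^ card {y \<in> A. y > x} * f v x * alternant f vs (A - {x}))"
    using xs by (intro sum.reindex_bij_betw bij_betw_nth) auto
  finally show ?thesis .
qed

text \<open>The zero block has \<open>n - j\<close> rows and \<open>j + 1\<close> columns. A permutation cannot send these \<open>n - j\<close> rows into
  the remaining \<open>n - j - 1\<close> columns.\<close>
lemma det_zero_block:
  assumes M: "M \<in> carrier_mat n n" and "j < n"
    and zero: "\<And>i j'. j \<le> i \<Longrightarrow> i < n \<Longrightarrow> j' \<le> j \<Longrightarrow> M $$ (i, j') = 0"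
  shows "det (M :: 'a::comm_ring_1 mat) = 0"
proof -
  have "(\<Prod>i = 0..<n. M $$ (i, \<sigma> i)) = 0" if \<sigma>: "\<sigma> permutes {0..<n}" for \<sigma>
  proof -
    have "\<exists>i\<in>{j..<n}. \<sigma> i \<le> j"
    proof (rule ccontr)
      assume "\<not> (\<exists>i\<in>{j..<n}. \<sigma> i \<le> j)"
      then have "\<sigma> ` {j..<n} \<subseteq> {Suc j..<n}"
        using permutes_in_image[OF \<sigma>] by (auto simp: not_le Suc_le_eq)
      then have "card {j..<n} \<le> card {Suc j..<n}"
        using inj_on_subset[OF permutes_inj_on[OF \<sigma>]] by (intro card_inj_on_le) auto
      then show False using \<open>j < n\<close> by simp
    qed
    then obtain i where i: "i \<in> {0..<n}" "j \<le> i" "\<sigma> i \<le> j" by auto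
    then have "M $$ (i, \<sigma> i) = 0" by (intro zero) auto
    with i show ?thesis by (intro prod_zero) auto
  qed
  then show ?thesis
    unfolding det_def'[OF M] by (intro sum.neutral) auto
qed

text \<open>With integer indices the commutation relation becomes a sum over the target value
  \<open>x = v - j\<close>, which may run over any sufficiently large set \<open>B\<close>: outside \<open>{v - k..v}\<close> either the
  coefficient or the operator vanishes.\<close>
definition q_star_int :: "int \<Rightarrow> symfun \<Rightarrow> symfun" where
  "q_star_int k f = (if k < 0 then 0 else q_star (nat k) f)"

lemma q_star_int_S_op:
  assumes "finite B" and "{v - k..v} \<subseteq> B"
  shows "q_star_int k (S_op (v + p) f) =
    (\<Sum>x\<in>B. scal (q_coeff (v - x)) (S_op (x + p) (q_star_int (k - (v - x)) f)))"
proof (cases "k < 0")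
  case True
  then have "scal (q_coeff (v - x)) (S_op (x + p) (q_star_int (k - (v - x)) f)) = 0" for x
    by (cases "x > v") (auto simp: q_coeff_def q_star_int_def linear_op_zero[OF linear_op_S_op])
  then have "(\<Sum>x\<in>B. scal (q_coeff (v - x)) (S_op (x + p) (q_star_int (k - (v - x)) f))) = 0"
    by (intro sum.neutral ballI)
  with True show ?thesis by (simp add: q_star_int_def)
next
  case False
  have "q_star_int k (S_op (v + p) f) =
      (\<Sum>j\<le>nat k. scal (q_coeff (int j)) (S_op (v + p - int j) (q_star (nat k - j) f)))"
    using False by (simp add: q_star_int_def q_star_S_op)
  also have "\<dots> = (\<Sum>x\<in>{v - k..v}. scal (q_coeff (v - x)) (S_op (x + p) (q_star_int (k - (v - x)) f)))"
    using False
    by (intro sum.reindex_bij_witness[of _ "\<lambda>x. nat (v - x)" "\<lambda>j. v - int j"])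
      (auto simp: q_star_int_def nat_diff_distrib' algebra_simps)
  also have "\<dots> = (\<Sum>x\<in>B. scal (q_coeff (v - x)) (S_op (x + p) (q_star_int (k - (v - x)) f)))"
    using assms
    by (intro sum.mono_neutral_left)
      (auto simp: q_coeff_def q_star_int_def linear_op_zero[OF linear_op_S_op])
  finally show ?thesis .
qed

text \<open>Expanding \<open>q\<^sub>k\<^sup>*\<close> past all factors gives a sum over all integer sequences; the alternating
  property collects the sequences with the same underlying set into a determinant. The induction
  does this one factor at a time: a choice of \<open>x\<close> for the first factor and of a set for the others
  with \<open>x\<close> not in it is the same as a set \<open>A\<close> with a marked element \<open>x\<close>, and the signed sum over
  \<open>x \<in> A\<close> is the Laplace expansion \<open>alternant_Cons\<close>. A fixed \<open>B\<close> serves for all factors, since the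
  remaining degree can only decrease when the coefficient is not zero.\<close>
lemma q_star_int_S_seq:
  assumes B: "finite B" and "\<And>v. v \<in> set vs \<Longrightarrow> {v - k..v} \<subseteq> B"
  shows "q_star_int k (S_seq p vs) =
    (\<Sum>A | A \<subseteq> B \<and> card A = length vs \<and> \<Sum>A = sum_list vs - k.
      scal (alternant (\<lambda>v x. q_coeff (v - x)) vs A) (S_seq p (desc A)))"
  using assms(2)
proof (induction vs arbitrary: k p)
  case Nil
  have "{A. A \<subseteq> B \<and> card A = length ([] :: int list) \<and> \<Sum>A = sum_list [] - k} = (if k = 0 then {{}} else {})"
    using finite_subset[OF _ B] by auto
  then show ?case
    by (auto simp: q_star_int_def q_star_one alternant_def desc_def)
next
  case (Cons v vs)
  let ?f = "\<lambda>v x. q_coeff (v - x)"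
  define \<A> where "\<A> k = {A. A \<subseteq> B \<and> card A = length vs \<and> \<Sum>A = sum_list vs - k}" for k
  define \<B> where "\<B> = {A. A \<subseteq> B \<and> card A = Suc (length vs) \<and> \<Sum>A = v + sum_list vs - k}"
  have fin: "finite A" if "A \<subseteq> B" for A using finite_subset[OF that B] .
  have fin\<A>: "finite (\<A> k)" for k
    unfolding \<A>_def by (rule finite_subset[of _ "Pow B"]) (use B in auto)
  have fin\<B>: "finite \<B>"
    unfolding \<B>_def by (rule finite_subset[of _ "Pow B"]) (use B in auto)
  let ?g = "\<lambda>x A. scal ((-1) ^ card {y \<in> A. y > x} * ?f v x * alternant ?f vs A) (S_seq p (desc (insert x A)))"
  have summand: "scal (?f v x) (S_op (x + p) (q_star_int (k - (v - x)) (S_seq (p + 1) vs))) =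
      (\<Sum>A\<in>\<A> (k - (v - x)). if x \<in> A then 0 else ?g x A)" for x
  proof (cases "x \<le> v")
    case True
    have "{w - (k - (v - x))..w} \<subseteq> B" if "w \<in> set vs" for w
    proof -
      have "{w - (k - (v - x))..w} \<subseteq> {w - k..w}" using True by auto
      with Cons.prems[of w] that show ?thesis by auto
    qed
    then have "q_star_int (k - (v - x)) (S_seq (p + 1) vs) =
        (\<Sum>A\<in>\<A> (k - (v - x)). scal (alternant ?f vs A) (S_seq (p + 1) (desc A)))"
      unfolding \<A>_def by (rule Cons.IH)
    then have "scal (?f v x) (S_op (x + p) (q_star_int (k - (v - x)) (S_seq (p + 1) vs))) =
        (\<Sum>A\<in>\<A> (k - (v - x)). scal (?f v x * alternant ?f vs A) (S_seq p (x # desc A)))"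
      by (simp add: linear_op_sum[OF linear_op_S_op] linear_op_scal[OF linear_op_S_op] symfun.scale_sum_right)
    also have "\<dots> = (\<Sum>A\<in>\<A> (k - (v - x)). if x \<in> A then 0 else ?g x A)"
      by (intro sum.cong refl)
        (auto simp: \<A>_def S_seq_insert[OF sorted_desc] set_desc fin mult_ac simp del: S_seq.simps)
    finally show ?thesis .
  next
    case False
    then have "?f v x = 0" by (simp add: q_coeff_def)
    then show ?thesis by (simp add: sum.neutral)
  qed
  have "q_star_int k (S_seq p (v # vs)) =
      (\<Sum>x\<in>B. \<Sum>A\<in>\<A> (k - (v - x)). if x \<in> A then 0 else ?g x A)"
    using Cons.prems[of v] by (simp add: q_star_int_S_op[OF B] summand)
  also have "\<dots> = (\<Sum>(x, A)\<in>Sigma B (\<lambda>x. \<A> (k - (v - x))). if x \<in> A then 0 else ?g x A)"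
    by (rule sum.Sigma) (auto simp: B fin\<A>)
  also have "\<dots> = (\<Sum>(x, A)\<in>{(x, A). x \<in> B \<and> A \<in> \<A> (k - (v - x)) \<and> x \<notin> A}. ?g x A)"
    using B fin\<A> by (intro sum.mono_neutral_cong_right finite_SigmaI) auto
  also have "\<dots> = (\<Sum>(A, x)\<in>Sigma \<B> (\<lambda>A. A). ?g x (A - {x}))"
  proof (rule sum.reindex_bij_witness[of _ "\<lambda>(A, x). (x, A - {x})" "\<lambda>(x, A). (insert x A, x)"])
    fix xA assume "xA \<in> {(x, A). x \<in> B \<and> A \<in> \<A> (k - (v - x)) \<and> x \<notin> A}"
    then show "(case xA of (x, A) \<Rightarrow> (insert x A, x)) \<in> Sigma \<B> (\<lambda>A. A)"
      using fin by (auto simp: \<A>_def \<B>_def)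
  next
    fix Ax assume "Ax \<in> Sigma \<B> (\<lambda>A. A)"
    then show "(case Ax of (A, x) \<Rightarrow> (x, A - {x})) \<in> {(x, A). x \<in> B \<and> A \<in> \<A> (k - (v - x)) \<and> x \<notin> A}"
      using fin by (auto simp: \<A>_def \<B>_def sum_diff1)
  next
    fix xA assume xA: "xA \<in> {(x, A). x \<in> B \<and> A \<in> \<A> (k - (v - x)) \<and> x \<notin> A}"
    obtain x A where "xA = (x, A)" by (cases xA)
    moreover from this xA have "insert x A - {x} = A" by auto
    ultimately show "(case case xA of (x, A) \<Rightarrow> (insert x A, x) of (A, x) \<Rightarrow> ?g x (A - {x})) =
        (case xA of (x, A) \<Rightarrow> ?g x A)"
      by (simp only: prod.case insert_absorb2 insert_Diff_single)
  qed auto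
  also have "\<dots> = (\<Sum>A\<in>\<B>. \<Sum>x\<in>A. ?g x (A - {x}))"
    using fin by (intro sum.Sigma[symmetric] fin\<B>) (auto simp: \<B>_def)
  also have "\<dots> = (\<Sum>A\<in>\<B>. scal (alternant ?f (v # vs) A) (S_seq p (desc A)))"
  proof (intro sum.cong refl)
    fix A assume "A \<in> \<B>"
    then have A: "finite A" "card A = Suc (length vs)" using fin by (auto simp: \<B>_def)
    have "{y \<in> A - {x}. y > x} = {y \<in> A. y > x}" for x by auto
    then show "(\<Sum>x\<in>A. ?g x (A - {x})) = scal (alternant ?f (v # vs) A) (S_seq p (desc A))"
      unfolding alternant_Cons[OF A] symfun.scale_sum_left
      by (intro sum.cong refl) (simp add: insert_absorb)
  qed
  finally show ?case by (simp add: \<B>_def)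
qed

section \<open>Partitions and their beta numbers\<close>

text \<open>The numbers \<open>\<lambda>\<^sub>i - i\<close>, positions counted from \<open>p\<close>. Up to a common shift they are
  the beta numbers (first column hook lengths) of a partition.\<close>
primrec beta_numbers :: "int \<Rightarrow> nat list \<Rightarrow> int list" where
  "beta_numbers p [] = []"
| "beta_numbers p (n # ns) = (int n - p) # beta_numbers (p + 1) ns"

lemma length_beta_numbers [simp]: "length (beta_numbers p ns) = length ns"
  by (induction ns arbitrary: p) simp_all

lemma nth_beta_numbers: "i < length ns \<Longrightarrow> beta_numbers p ns ! i = int (ns ! i) - p - int i"
  by (induction ns arbitrary: p i) (auto simp: nth_Cons split: nat.split)

text \<open>The shift by positions contributes a constant, which depends only on the length.\<close>
lemma sum_list_beta_numbers:
  "sum_list (beta_numbers p ns) = int (sum_list ns) + sum_list (beta_numbers p (replicate (length ns) 0))"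
  by (induction ns arbitrary: p) simp_all

lemma sorted_beta_numbers:
  assumes "sorted_wrt (\<ge>) ns"
  shows "sorted_wrt (>) (beta_numbers p ns)"
proof -
  have "ns ! j \<le> ns ! i" if "i < j" "j < length ns" for i j
    using sorted_wrt_nth_less[OF assms that] .
  then show ?thesis
    by (force simp: sorted_wrt_iff_nth_less nth_beta_numbers)
qed

lemma S_seq_beta_numbers: "S_seq p (beta_numbers p ns) = S_one ns"
  by (induction ns arbitrary: p) (simp_all add: S_one_def)

text \<open>The last factor is applied to \<open>1\<close>, where \<open>S\<^sub>n\<close> gives \<open>h\<^sub>n = 0\<close> for negative \<open>n\<close>.\<close>
lemma S_seq_last_neg: "x + p + int (length xs) < 0 \<Longrightarrow> S_seq p (xs @ [x]) = 0"
  by (induction xs arbitrary: p)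
    (simp_all add: S_op_one hsym_neg linear_op_zero[OF linear_op_S_op])

lemma S_one_append_zeros: "S_one (ns @ replicate n 0) = S_one ns"
proof -
  have "foldr (\<lambda>n f. S_op (int n) f) (replicate n 0) 1 = 1"
    by (induction n) (simp_all add: S_op_one hsym_0)
  then show ?thesis by (simp add: S_one_def)
qed

definition pad :: "nat \<Rightarrow> nat list \<Rightarrow> nat list" where
  "pad l mu = mu @ replicate (l - length mu) 0"

lemma nth_pad: "i < l \<Longrightarrow> length mu \<le> l \<Longrightarrow> pad l mu ! i = part mu i"
  by (auto simp: pad_def nth_append part_def)

lemma length_pad: "length mu \<le> l \<Longrightarrow> length (pad l mu) = l"
  by (simp add: pad_def)

lemma filter_pad: "is_partition mu \<Longrightarrow> filter (\<lambda>n. n > 0) (pad l mu) = mu"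
  by (simp add: pad_def is_partition_def)

lemma sorted_pad: "is_partition mu \<Longrightarrow> sorted_wrt (\<ge>) (pad l mu)"
  unfolding pad_def is_partition_def sorted_wrt_append
  by (auto simp: sorted_wrt_iff_nth_less[of _ "replicate _ _"])

lemma sum_list_pad: "sum_list (pad l mu) = sum_list mu"
  by (simp add: pad_def)

lemma pad_filter:
  assumes "sorted_wrt (\<ge>) ns"
  shows "pad (length ns) (filter (\<lambda>n. n > 0) ns) = ns"
  using assms
proof (induction ns)
  case (Cons n ns)
  show ?case
  proof (cases "n = 0")
    case True
    then have "\<forall>m\<in>set ns. m = 0" using Cons.prems by auto
    then have "filter (\<lambda>n. n > 0) (n # ns) = []" and "replicate (length (n # ns)) 0 = n # ns"
      using True by (auto simp: filter_empty_conv intro!: replicate_length_same)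
    then show ?thesis unfolding pad_def by (simp only:) simp
  next
    case False
    with Cons show ?thesis by (simp add: pad_def Suc_diff_le)
  qed
qed (simp add: pad_def)

definition beta_set :: "nat \<Rightarrow> nat list \<Rightarrow> int set" where
  "beta_set l mu = set (beta_numbers 0 (pad l mu))"

lemma desc_beta_set: "is_partition mu \<Longrightarrow> desc (beta_set l mu) = beta_numbers 0 (pad l mu)"
  by (simp add: beta_set_def desc_unique sorted_beta_numbers sorted_pad)

lemma part_subset_length:
  assumes "is_partition mu" and "part_subset mu lam"
  shows "length mu \<le> length lam"
proof (rule ccontr)
  assume "\<not> length mu \<le> length lam"
  then have "part mu (length lam) > 0"
    using assms(1) by (auto simp: part_def is_partition_def)
  moreover have "part mu (length lam) \<le> part lam (length lam)"
    using assms(2) by (simp add: part_subset_def)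
  ultimately show False by (simp add: part_def)
qed

text \<open>The sequence \<open>\<mu>\<^sub>j = u\<^sub>j + j\<close> belonging to a strictly decreasing sequence \<open>u\<close> of integers is weakly
  decreasing.\<close>
lemma desc_drop:
  assumes "j \<le> j'" and "j' < card A"
  shows "desc A ! j' + int j' \<le> desc A ! j + int j"
  using assms
proof (induction j' rule: dec_induct)
  case (step m)
  have "desc A ! m > desc A ! Suc m"
    using sorted_wrt_nth_less[OF sorted_desc] step.prems by (simp add: length_desc)
  with step show ?case by simp
qed simp

lemma one_minus_tvar_neq_0: "1 - tvar \<noteq> 0"
  by (simp add: tvar_def One_fract_def Zero_fract_def eq_fract one_pCons)

text \<open>The factor \<open>(1 - t)\<^sup>l\<close> is absorbed into the rows; it turns the entries \<open>(1 - t)\<^sup>-\<^sup>1\<close>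
  into \<open>1\<close> and the other nonzero entries into \<open>1 - t\<close>.\<close>
lemma alternant_beta_set:
  assumes "is_partition mu" and "length mu \<le> length lam"
  shows "alternant (\<lambda>v x. q_coeff (v - x)) (beta_numbers 0 lam) (beta_set (length lam) mu) =
    (1 - tvar) ^ length lam * det (skew_mat lam mu)"
proof -
  let ?l = "length lam"
  have "mat ?l ?l (\<lambda>(i, j). q_coeff (beta_numbers 0 lam ! i - desc (beta_set ?l mu) ! j)) =
      (1 - tvar) \<cdot>\<^sub>m skew_mat lam mu"
    using assms one_minus_tvar_neq_0
    by (intro eq_matI)
      (auto simp: skew_mat_def desc_beta_set nth_beta_numbers length_pad nth_pad q_coeff_def part_def)
  then show ?thesis
    by (simp add: alternant_def skew_mat_def)
qed

lemma S_seq_beta_set: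
  assumes "is_partition mu"
  shows "S_seq 0 (desc (beta_set l mu)) = S_one mu"
  using assms by (simp add: desc_beta_set S_seq_beta_numbers) (simp add: pad_def S_one_append_zeros)

text \<open>Let \<open>\<mu>\<^sub>j = u\<^sub>j + j\<close>, where \<open>u\<close> enumerates \<open>A\<close> decreasingly. If \<open>\<mu>\<^sub>j > \<lambda>\<^sub>j\<close> and \<open>j' \<le> j \<le> i\<close>, then
  \<open>\<mu>\<close> at \<open>j'\<close> is at least \<open>\<mu>\<^sub>j > \<lambda>\<^sub>j \<ge> \<lambda>\<^sub>i\<close>, so the lower left part of the matrix is a zero block that is too
  large. This is where the sum is cut down to \<open>\<mu> \<subset> \<lambda>\<close>.\<close>
lemma alternant_eq_0:
  assumes "is_partition lam" and "card A = length lam" and j: "j < length lam"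
    and above: "desc A ! j + int j > int (lam ! j)"
  shows "alternant (\<lambda>v x. q_coeff (v - x)) (beta_numbers 0 lam) A = 0"
proof -
  have "q_coeff (beta_numbers 0 lam ! i - desc A ! j') = 0" if "j \<le> i" "i < length lam" "j' \<le> j" for i j'
  proof -
    have "lam ! i \<le> lam ! j"
      using assms(1) that sorted_wrt_nth_less[of "(\<ge>)" lam j i]
      by (cases "i = j") (auto simp: is_partition_def)
    moreover have "desc A ! j + int j \<le> desc A ! j' + int j'"
      using that j assms(2) by (intro desc_drop) auto
    ultimately show ?thesis
      using above that by (simp add: nth_beta_numbers q_coeff_def)
  qed
  with j show ?thesis
    unfolding alternant_def by (intro det_zero_block[of _ "length lam" j]) auto
qed

text \<open>The numbers \<open>\<mu>\<^sub>j = u\<^sub>j + j\<close> are the indices of the factors. If one is negative then so is the last,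
  because they decrease weakly.\<close>
lemma S_seq_desc_eq_0:
  assumes "j < card A" and "desc A ! j + int j < 0"
  shows "S_seq 0 (desc A) = 0"
proof -
  define m where "m = card A - 1"
  have m: "m < card A" "j \<le> m" using assms(1) by (auto simp: m_def)
  then have "desc A ! m + int m < 0"
    using desc_drop[of j m A] assms(2) by simp
  moreover have "desc A = take m (desc A) @ [desc A ! m]"
    using m by (metis Suc_diff_1 gr_implies_not0 length_desc m_def neq0_conv order_refl
        take_Suc_conv_app_nth take_all)
  ultimately show ?thesis
    using S_seq_last_neg[of "desc A ! m" 0 "take m (desc A)"] m by (simp add: length_desc)
qed

text \<open>The two preceding lemmas leave only the sets with \<open>0 \<le> \<mu>\<^sub>j \<le> \<lambda>\<^sub>j\<close> for all \<open>j\<close>, and these are the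
  sets of beta numbers of partitions \<open>\<mu> \<subset> \<lambda>\<close>.\<close>
lemma ex_partition_beta_set:
  assumes lam: "is_partition lam" and A: "finite A" "card A = length lam"
    and alt: "alternant (\<lambda>v x. q_coeff (v - x)) (beta_numbers 0 lam) A \<noteq> 0"
    and S: "S_seq 0 (desc A) \<noteq> 0"
  obtains mu where "is_partition mu" "part_subset mu lam" "beta_set (length lam) mu = A"
proof -
  let ?l = "length lam"
  define w where "w j = desc A ! j + int j" for j
  have antimono: "w j' \<le> w j" if "j \<le> j'" "j' < ?l" for j j'
    using desc_drop[of j j' A] that A by (simp add: w_def)
  have upper: "w j \<le> int (lam ! j)" if "j < ?l" for j
    using alternant_eq_0[OF lam A(2) that] alt by (force simp: w_def)
  have nonneg: "w j \<ge> 0" if "j < ?l" for j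
    using S_seq_desc_eq_0[of j A] S that A by (force simp: w_def)
  define ns where "ns = map (\<lambda>j. nat (w j)) [0..<?l]"
  have sorted: "sorted_wrt (\<ge>) ns"
    using antimono by (auto simp: ns_def sorted_wrt_iff_nth_less intro: nat_mono)
  define mu where "mu = filter (\<lambda>n. n > 0) ns"
  have pad: "pad ?l mu = ns"
    using pad_filter[OF sorted] by (simp add: mu_def ns_def)
  have len: "length mu \<le> ?l"
    unfolding mu_def by (rule order_trans[OF length_filter_le]) (simp add: ns_def)
  show ?thesis
  proof (rule that)
    show "is_partition mu"
      using sorted by (auto simp: is_partition_def mu_def sorted_wrt_filter)
    show "part_subset mu lam"
      unfolding part_subset_def
    proof
      fix i
      show "part mu i \<le> part lam i"
      proof (cases "i < ?l")
        case True
        then have "part mu i = nat (w i)"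
          using nth_pad[OF True len] by (simp add: pad ns_def)
        then show ?thesis using upper[OF True] True by (simp add: part_def)
      qed (use len in \<open>simp add: part_def\<close>)
    qed
    have "beta_numbers 0 ns = desc A"
      using A nonneg by (intro nth_equalityI) (auto simp: ns_def nth_beta_numbers length_desc w_def)
    then show "beta_set ?l mu = A"
      using A by (simp add: beta_set_def pad set_desc)
  qed
qed

lemma sum_beta_set:
  assumes "is_partition mu" and "length mu \<le> length lam"
  shows "\<Sum>(beta_set (length lam) mu) - sum_list (beta_numbers 0 lam) = int (sum_list mu) - int (sum_list lam)"
proof -
  have "\<Sum>(beta_set (length lam) mu) = sum_list (beta_numbers 0 (pad (length lam) mu))"
    using distinct_desc[of "beta_set (length lam) mu"] desc_beta_set[OF assms(1)]
    by (simp add: beta_set_def distinct_sum_list_conv_Sum)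
  also have "\<dots> = int (sum_list mu) + sum_list (beta_numbers 0 (replicate (length lam) 0))"
    using sum_list_beta_numbers[of 0 "pad (length lam) mu"] assms by (simp add: sum_list_pad length_pad)
  finally show ?thesis using sum_list_beta_numbers[of 0 lam] by simp
qed

theorem theorem4p1:
  fixes lam :: "nat list" and l k :: nat
  assumes "is_partition lam" and "length lam = l" and "k > 0"
  shows "q_star k (S_one lam) =
    (\<Sum>mu | is_partition mu \<and> part_subset mu lam \<and> sum_list lam - sum_list mu = k.
       scal ((1 - tvar) ^ l * det (skew_mat lam mu)) (S_one mu))"
proof -
  \<comment> \<open>Large enough for all entries \<open>\<lambda>\<^sub>i - \<alpha>\<^sub>i - i\<close> with \<open>|\<alpha>| = k\<close>, and for \<open>\<mu>\<^sub>j - j\<close> with \<open>\<mu> \<subset> \<lambda>\<close>.\<close>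
  define B where "B = {- int l - int k .. int (sum_list lam)}"
  define Mus where "Mus = {mu. is_partition mu \<and> part_subset mu lam \<and> sum_list lam - sum_list mu = k}"
  define \<A> where "\<A> = {A. A \<subseteq> B \<and> card A = l \<and> \<Sum>A = sum_list (beta_numbers 0 lam) - int k}"
  let ?g = "\<lambda>A. scal (alternant (\<lambda>v x. q_coeff (v - x)) (beta_numbers 0 lam) A) (S_seq 0 (desc A))"
  have part_le: "part lam i \<le> sum_list lam" for i
    by (simp add: part_def member_le_sum_list)
  have "{v - int k..v} \<subseteq> B" if v: "v \<in> set (beta_numbers 0 lam)" for v
  proof -
    obtain i where "i < length lam" "v = beta_numbers 0 lam ! i"
      using v by (auto simp: in_set_conv_nth)
    then have "i < l" "v = int (lam ! i) - int i"
      using assms by (simp_all add: nth_beta_numbers)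
    then show ?thesis
      using part_le[of i] assms by (auto simp: B_def part_def)
  qed
  then have "q_star_int (int k) (S_seq 0 (beta_numbers 0 lam)) = (\<Sum>A\<in>\<A>. ?g A)"
    unfolding \<A>_def using assms by (subst q_star_int_S_seq[of B]) (auto simp: B_def)
  then have "q_star k (S_one lam) = (\<Sum>A\<in>\<A>. ?g A)"
    by (simp add: q_star_int_def S_seq_beta_numbers)
  also have "\<dots> = (\<Sum>A\<in>beta_set l ` Mus. ?g A)"
  proof (rule sum.mono_neutral_right)
    show "finite \<A>"
      unfolding \<A>_def by (rule finite_subset[of _ "Pow B"]) (auto simp: B_def)
    show "beta_set l ` Mus \<subseteq> \<A>"
    proof (intro image_subsetI)
      fix mu assume "mu \<in> Mus"
      then have mu: "is_partition mu" "part_subset mu lam" "sum_list lam - sum_list mu = k"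
        by (auto simp: Mus_def)
      have len: "length mu \<le> l" using part_subset_length[OF mu(1,2)] assms by simp
      have "beta_set l mu \<subseteq> B"
      proof
        fix x assume "x \<in> beta_set l mu"
        then obtain i where i: "i < l" "x = int (part mu i) - int i"
          using len by (auto simp: beta_set_def in_set_conv_nth nth_beta_numbers length_pad nth_pad)
        moreover have "part mu i \<le> sum_list lam"
          using mu(2) part_le[of i] le_trans unfolding part_subset_def by blast
        ultimately show "x \<in> B" by (auto simp: B_def)
      qed
      moreover have "card (beta_set l mu) = l"
        using desc_beta_set[OF mu(1), of l] length_desc[of "beta_set l mu"] len by (simp add: length_pad)
      moreover have "\<Sum>(beta_set l mu) = sum_list (beta_numbers 0 lam) - int k"
        using sum_beta_set[of mu lam] mu len assms by simp
      ultimately show "beta_set l mu \<in> \<A>" by (simp add: \<A>_def)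
    qed
    show "\<forall>A\<in>\<A> - beta_set l ` Mus. ?g A = 0"
    proof (rule ballI, rule ccontr)
      fix A assume A: "A \<in> \<A> - beta_set l ` Mus" and "?g A \<noteq> 0"
      then have "finite A" "card A = length lam"
        using assms finite_subset[of A B] by (auto simp: \<A>_def B_def)
      then obtain mu where mu: "is_partition mu" "part_subset mu lam" "beta_set l mu = A"
        using \<open>?g A \<noteq> 0\<close> ex_partition_beta_set[OF assms(1), of A] assms(2) by auto
      then have "int (sum_list mu) - int (sum_list lam) = - int k"
        using sum_beta_set[of mu lam] part_subset_length[of mu lam] A assms by (auto simp: \<A>_def)
      then have "mu \<in> Mus" using mu by (auto simp: Mus_def)
      then show False using A mu by auto
    qed
  qed
  also have "\<dots> = (\<Sum>mu\<in>Mus. ?g (beta_set l mu))"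
  proof (intro sum.reindex[unfolded o_def] inj_onI)
    fix mu nu assume *: "mu \<in> Mus" "nu \<in> Mus" "beta_set l mu = beta_set l nu"
    then have "beta_numbers 0 (pad l mu) = beta_numbers 0 (pad l nu)"
      by (metis (no_types, lifting) Mus_def desc_beta_set mem_Collect_eq)
    then have "pad l mu = pad l nu"
      by (metis add.commute length_beta_numbers nth_beta_numbers nth_equalityI of_nat_eq_iff
          diff_add_cancel)
    then show "mu = nu"
      using * filter_pad by (metis (no_types, lifting) Mus_def mem_Collect_eq)
  qed
  also have "\<dots> = (\<Sum>mu\<in>Mus. scal ((1 - tvar) ^ l * det (skew_mat lam mu)) (S_one mu))"
    using assms part_subset_length alternant_beta_set
    by (intro sum.cong refl) (auto simp: Mus_def S_seq_beta_set)
  finally show ?thesis by (simp add: Mus_def)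
qed

end
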